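(* Let $\varphi$ be an automorphism of a group $G$, and let \[ S:=\{x\in\operatorname{Fix}\varphi\mid \varphi^2(y)=xyx^{-1}\text{ for all }y\in G\}. \] Then \[ |\operatorname{Good}(\operatorname{Conj}(G,\varphi))|\geq|S|. \]
   Context: A quandle is a pair $(X,s)$ where $X$ is a set and $s:X\to S_X$, $x\mapsto s_x$, is a function to the symmetric group $S_X$ such that $s_xs_y=s_{s_x(y)}s_x$ and $s_x(x)=x$ for all $x,y\in X$. For a group $G$ and $\varphi\in\operatorname{Aut}G$, the twisted conjugation quandle $\operatorname{Conj}(G,\varphi)$ has underlying set $G$ and $s_g(h):=\varphi(g^{-1}h)g$ for all $g,h\in G$. $\operatorname{Fix}\varphi\leq G$ is the subgroup of fixed points of $\varphi$. A good involution of a quandle $(X,s)$ is a permutation $\rho\in S_X$ with $\rho^2=\mathrm{id}_X$ (the identity map is allowed) such that $\rho s_x=s_x\rho$ and $s_{\rho(x)}=s_x^{-1}$ for all $x\in X$. $\operatorname{Good}Q$ denotes the set of all good involutions of $Q$. *)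

theory Defs
  imports "HOL-Algebra.Bij" "HOL-Library.Equipollence"
begin

text \<open>
  The symmetric group of a set \<open>X\<close> is \<^const>\<open>BijGroup\<close> \<open>X\<close>. Its elements are extensional, so that each
  permutation of \<open>X\<close> is represented by exactly one function; this is what makes the cardinality of
  a set of permutations meaningful.
\<close>

type_synonym 'a quandle_structure = "'a set \<times> ('a \<Rightarrow> 'a \<Rightarrow> 'a)"

definition quandle :: "'a quandle_structure \<Rightarrow> bool" where
  "quandle = (\<lambda>(X, s).
     s \<in> X \<rightarrow> carrier (BijGroup X) \<and>
     (\<forall>x\<in>X. \<forall>y\<in>X. s x \<otimes>\<^bsub>BijGroup X\<^esub> s y = s (s x y) \<otimes>\<^bsub>BijGroup X\<^esub> s x) \<and>
     (\<forall>x\<in>X. s x x = x))"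

definition Good :: "'a quandle_structure \<Rightarrow> ('a \<Rightarrow> 'a) set" where
  "Good = (\<lambda>(X, s). {\<rho> \<in> carrier (BijGroup X).
     \<rho> \<otimes>\<^bsub>BijGroup X\<^esub> \<rho> = \<one>\<^bsub>BijGroup X\<^esub> \<and>
     (\<forall>x\<in>X. \<rho> \<otimes>\<^bsub>BijGroup X\<^esub> s x = s x \<otimes>\<^bsub>BijGroup X\<^esub> \<rho> \<and>
             s (\<rho> x) = inv\<^bsub>BijGroup X\<^esub> (s x))})"

definition Conj :: "('a, 'b) monoid_scheme \<Rightarrow> ('a \<Rightarrow> 'a) \<Rightarrow> 'a quandle_structure" where
  "Conj G \<phi> = (carrier G,
     \<lambda>g\<in>carrier G. \<lambda>h\<in>carrier G. \<phi> (inv\<^bsub>G\<^esub> g \<otimes>\<^bsub>G\<^esub> h) \<otimes>\<^bsub>G\<^esub> g)"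

definition Fix :: "('a, 'b) monoid_scheme \<Rightarrow> ('a \<Rightarrow> 'a) \<Rightarrow> 'a set" where
  "Fix G \<phi> = {x \<in> carrier G. \<phi> x = x}"

lemma quandleI:
  assumes "\<And>x. x \<in> X \<Longrightarrow> s x \<in> Bij X"
    and "\<And>x y. x \<in> X \<Longrightarrow> y \<in> X \<Longrightarrow> compose X (s x) (s y) = compose X (s (s x y)) (s x)"
    and "\<And>x. x \<in> X \<Longrightarrow> s x x = x"
  shows "quandle (X, s)"
proof -
  have "s (s x y) \<in> Bij X" if "x \<in> X" "y \<in> X" for x y
    using assms(1) that Bij_imp_funcset[THEN funcset_mem] by metis
  then show ?thesis
    using assms by (simp add: quandle_def BijGroup_def)
qed

lemma quandle_Conj:
  fixes G (structure)
  assumes "group G" and "\<phi> \<in> auto G"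
  shows "quandle (Conj G \<phi>)"
proof -
  interpret group G by fact
  have hom: "\<phi> \<in> hom G G" and bij: "bij_betw \<phi> (carrier G) (carrier G)"
    using assms(2) by (auto simp: auto_def Bij_def)
  interpret \<phi>: group_hom G G \<phi>
    using hom by unfold_locales
  let ?s = "\<lambda>g\<in>carrier G. \<lambda>h\<in>carrier G. \<phi> (inv g \<otimes> h) \<otimes> g"
  have s_Bij: "?s g \<in> Bij (carrier G)" if g: "g \<in> carrier G" for g
  proof -
    have l: "bij_betw (\<lambda>h. inv g \<otimes> h) (carrier G) (carrier G)"
      by (rule bij_betw_byWitness[where f' = "\<lambda>h. g \<otimes> h"])
         (use g in \<open>auto simp flip: m_assoc\<close>)
    have r: "bij_betw (\<lambda>h. h \<otimes> g) (carrier G) (carrier G)"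
      by (rule bij_betw_byWitness[where f' = "\<lambda>h. h \<otimes> inv g"])
         (use g in \<open>auto simp: m_assoc\<close>)
    have "bij_betw (\<lambda>h. \<phi> (inv g \<otimes> h) \<otimes> g) (carrier G) (carrier G)"
      using bij_betw_trans[OF bij_betw_trans[OF l bij] r] by (simp add: o_def)
    then have "bij_betw (?s g) (carrier G) (carrier G)"
      using g by (simp cong: bij_betw_cong)
    then show ?thesis using g by (simp add: Bij_def)
  qed
  have pointwise: "?s x (?s y h) = ?s (?s x y) (?s x h)"
    if x: "x \<in> carrier G" and y: "y \<in> carrier G" and h: "h \<in> carrier G" for x y h
  proof -
    let ?u = "\<phi> (inv y \<otimes> h)" and ?v = "\<phi> (inv x \<otimes> y)" and ?w = "\<phi> (inv x \<otimes> h)"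
    have "inv ?v \<otimes> ?w = \<phi> (inv (inv x \<otimes> y) \<otimes> (inv x \<otimes> h))"
      using x y h by (simp add: inv_mult_group)
    also have "inv (inv x \<otimes> y) \<otimes> (inv x \<otimes> h) = inv y \<otimes> h"
      using x y h by (simp add: inv_mult_group m_assoc) (simp flip: m_assoc)
    finally have "inv ?v \<otimes> ?w = ?u" .
    moreover have "inv (v \<otimes> x) \<otimes> (w \<otimes> x) = inv x \<otimes> (inv v \<otimes> w) \<otimes> x"
      if "v \<in> carrier G" "w \<in> carrier G" for v w
      using x that by (simp add: inv_mult_group m_assoc)
    ultimately have "inv (?v \<otimes> x) \<otimes> (?w \<otimes> x) = inv x \<otimes> ?u \<otimes> x"
      using x y h by (metis \<phi>.hom_closed inv_closed m_closed)
    moreover have "\<phi> (inv x \<otimes> u \<otimes> x) \<otimes> (?v \<otimes> x) = \<phi> (inv x \<otimes> (u \<otimes> y)) \<otimes> x"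
      if u: "u \<in> carrier G" for u
    proof -
      have "inv x \<otimes> u \<otimes> x \<otimes> (inv x \<otimes> y) = inv x \<otimes> (u \<otimes> y)"
        using x y u by (metis inv_closed inv_solve_left m_assoc m_closed)
      then show ?thesis
        using x y u by (metis \<phi>.hom_closed \<phi>.hom_mult inv_closed m_assoc m_closed)
    qed
    ultimately show ?thesis
      using x y h by (simp del: \<phi>.hom_mult \<phi>.hom_inv)
  qed
  have "compose (carrier G) (?s x) (?s y) = compose (carrier G) (?s (?s x y)) (?s x)"
    if "x \<in> carrier G" "y \<in> carrier G" for x y
    unfolding compose_def by (rule restrict_ext) (use pointwise[OF that] in blast)
  moreover have "?s x x = x" if "x \<in> carrier G" for x
    using that by simp
  ultimately show ?thesis
    unfolding Conj_def using s_Bij by (intro quandleI)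
qed

end

theory Submission
  imports Defs
begin

text \<open>
  Each \<open>x\<close> in the set \<open>S\<close> on the left yields the map \<open>\<rho>\<^sub>x(g) = \<phi>(g\<^sup>-\<^sup>1) x\<close>, and evaluation at the
  neutral element recovers \<open>x\<close> from it, so that only \<open>\<rho>\<^sub>x \<in> Good (Conj G \<phi>)\<close> has to be shown.

  The formula is forced by the condition on inverses. Solving \<open>\<phi>(g\<^sup>-\<^sup>1 h) g = k\<close> for \<open>h\<close> gives
  \<open>s\<^sub>g\<^sup>-\<^sup>1(k) = g \<phi>\<^sup>-\<^sup>1(k) \<phi>\<^sup>-\<^sup>1(g\<^sup>-\<^sup>1)\<close>. For \<open>x \<in> S\<close> one has \<open>\<phi>\<^sup>-\<^sup>1(y) = x\<^sup>-\<^sup>1 \<phi>(y) x\<close>, hence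
  \<open>s\<^sub>g\<^sup>-\<^sup>1(k) = (g x\<^sup>-\<^sup>1) \<phi>(k) (\<phi>(g\<^sup>-\<^sup>1) x)\<close>. This has the shape \<open>\<phi>(r\<^sup>-\<^sup>1) \<phi>(k) r\<close> of \<open>s\<^sub>r(k)\<close> with
  \<open>r = \<phi>(g\<^sup>-\<^sup>1) x\<close>, because \<open>\<phi>(r\<^sup>-\<^sup>1) = x\<^sup>-\<^sup>1 \<phi>\<^sup>2(g) = g x\<^sup>-\<^sup>1\<close>. That \<open>\<rho>\<^sub>x\<close> is an involution and commutes
  with every \<open>s\<^sub>g\<close> follows in the same way from \<open>\<phi>(x) = x\<close> and \<open>\<phi>\<^sup>2(y) = x y x\<^sup>-\<^sup>1\<close>.
\<close>

definition twisted_inversion :: "('a, 'b) monoid_scheme \<Rightarrow> ('a \<Rightarrow> 'a) \<Rightarrow> 'a \<Rightarrow> 'a \<Rightarrow> 'a" where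
  "twisted_inversion G \<phi> x = (\<lambda>g\<in>carrier G. \<phi> (inv\<^bsub>G\<^esub> g) \<otimes>\<^bsub>G\<^esub> x)"

text \<open>
  Membership in \<^const>\<open>Good\<close> is a statement about extensional functions in the symmetric group;
  this reduces it to identities between values. A left inverse suffices for the condition on
  \<open>s (\<rho> x)\<close>, since both factors are permutations.
\<close>

lemma GoodI:
  assumes s: "\<And>x. x \<in> X \<Longrightarrow> s x \<in> Bij X"
    and ext: "\<rho> \<in> extensional X"
    and closed: "\<And>x. x \<in> X \<Longrightarrow> \<rho> x \<in> X"
    and invol: "\<And>x. x \<in> X \<Longrightarrow> \<rho> (\<rho> x) = x"
    and comm: "\<And>x y. x \<in> X \<Longrightarrow> y \<in> X \<Longrightarrow> \<rho> (s x y) = s x (\<rho> y)"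
    and left_inv: "\<And>x y. x \<in> X \<Longrightarrow> y \<in> X \<Longrightarrow> s (\<rho> x) (s x y) = y"
  shows "\<rho> \<in> Good (X, s)"
proof -
  have \<rho>: "\<rho> \<in> Bij X"
    using ext closed invol by (auto simp: Bij_def intro!: bij_betw_byWitness[where f' = \<rho>])
  have "s (\<rho> x) = inv\<^bsub>BijGroup X\<^esub> (s x)" if x: "x \<in> X" for x
  proof (rule group.inv_equality[OF group_BijGroup, symmetric])
    have "compose X (s (\<rho> x)) (s x) = (\<lambda>y\<in>X. y)"
      unfolding compose_def by (rule restrict_ext) (rule left_inv[OF x])
    then show "s (\<rho> x) \<otimes>\<^bsub>BijGroup X\<^esub> s x = \<one>\<^bsub>BijGroup X\<^esub>"
      using s x closed by (simp add: BijGroup_def)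
  qed (use s x closed in \<open>simp_all add: BijGroup_def\<close>)
  moreover have "compose X \<rho> \<rho> = (\<lambda>y\<in>X. y)"
    unfolding compose_def by (rule restrict_ext) (rule invol)
  moreover have "compose X \<rho> (s x) = compose X (s x) \<rho>" if "x \<in> X" for x
    unfolding compose_def by (rule restrict_ext) (rule comm[OF that])
  ultimately show ?thesis
    using \<rho> s by (simp add: Good_def BijGroup_def)
qed

lemma quandle_Bij:
  assumes "quandle (X, s)" and "x \<in> X"
  shows "s x \<in> Bij X"
  using assms by (auto simp: quandle_def BijGroup_def)

lemma twisted_inversion_Good:
  fixes G (structure)
  assumes "group G" and "\<phi> \<in> auto G"
    and x: "x \<in> Fix G \<phi>"
    and square: "\<And>y. y \<in> carrier G \<Longrightarrow> \<phi> (\<phi> y) = x \<otimes> y \<otimes> inv x"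
  shows "twisted_inversion G \<phi> x \<in> Good (Conj G \<phi>)"
proof -
  interpret group G by fact
  interpret \<phi>: group_hom G G \<phi>
    using assms(2) by unfold_locales (simp add: auto_def)
  have xG: "x \<in> carrier G" and fixed: "\<phi> x = x"
    using x by (auto simp: Fix_def)
  have cancel: "inv a \<otimes> (a \<otimes> b) = b" "a \<otimes> (inv a \<otimes> b) = b"
    if "a \<in> carrier G" "b \<in> carrier G" for a b
    using that by (simp_all flip: m_assoc)
  show ?thesis
    unfolding Conj_def
  proof (rule GoodI)
    show "(\<lambda>g\<in>carrier G. \<lambda>h\<in>carrier G. \<phi> (inv g \<otimes> h) \<otimes> g) g \<in> Bij (carrier G)"
      if "g \<in> carrier G" for g
      by (rule quandle_Bij[OF quandle_Conj[OF assms(1,2), unfolded Conj_def] that])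
  qed (simp_all add: twisted_inversion_def xG fixed square m_assoc inv_mult_group cancel)
qed

theorem corollary3p8:
  fixes G :: "('a, 'b) monoid_scheme" (structure)
    and \<phi> :: "'a \<Rightarrow> 'a"
  assumes "group G"
    and "\<phi> \<in> auto G"
  shows "{x \<in> Fix G \<phi>. \<forall>y\<in>carrier G. \<phi> (\<phi> y) = x \<otimes> y \<otimes> inv x} \<lesssim> Good (Conj G \<phi>)"
proof -
  interpret group G by fact
  interpret \<phi>: group_hom G G \<phi>
    using assms(2) by unfold_locales (simp add: auto_def)
  let ?S = "{x \<in> Fix G \<phi>. \<forall>y\<in>carrier G. \<phi> (\<phi> y) = x \<otimes> y \<otimes> inv x}"
  have at_one: "twisted_inversion G \<phi> x \<one> = x" if "x \<in> ?S" for x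
    using that by (simp add: twisted_inversion_def Fix_def)
  have "inj_on (twisted_inversion G \<phi>) ?S"
    by (rule inj_on_inverseI[where g = "\<lambda>\<rho>. \<rho> \<one>"]) (rule at_one)
  moreover have "twisted_inversion G \<phi> ` ?S \<subseteq> Good (Conj G \<phi>)"
    using twisted_inversion_Good[OF assms] by blast
  ultimately show ?thesis
    unfolding lepoll_def by blast
qed

end
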